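(* Let $p$ be a prime, let $r\ge 1$, and let $\alpha_1,\dots,\alpha_r$ be nonnegative integers with $\alpha_1\ge\alpha_i$ for all $2\le i\le r$ (i.e. $\alpha_1\ge\max\{\alpha_2,\alpha_3,\dots,\alpha_r\}$). Then $$\mathsf{K}_1\bigl(C_{p^{\alpha_1+1}}\oplus C_{p^{\alpha_2}}\oplus\cdots\oplus C_{p^{\alpha_r}}\bigr)=\mathsf{K}_1\bigl(C_{p^{\alpha_1}}\oplus C_{p^{\alpha_2}}\oplus\cdots\oplus C_{p^{\alpha_r}}\bigr)+\frac{1}{p^{\alpha_1}}.$$
   Context: Groups are finite abelian, written additively; $C_m$ is the cyclic group of order $m$; $\mathbb{N}=\mathbb{Z}_{\ge 0}$; $G^{\bullet}=G\setminus\{0\}$. An indexed sequence over $G$ is an element of the free abelian monoid (written multiplicatively, identity $1$) on $G^{\bullet}\times\mathbb{N}$; all indexed sequences are assumed squarefree, i.e. every pair $(g,n)$ occurs with multiplicity at most one, so an indexed sequence is a finite set of labelled nonzero elements of $G$ (the same $g$ may occur with several labels). For an indexed sequence $S$, $\overline{v}_g(S)$ is the number of terms of $S$ with first coordinate $g$, and $\overline{\sigma}(S)=\sum_{g\in G^\bullet}\overline{v}_g(S)\,g\in G$. A subsequence of $S$ is a divisor of $S$ in the monoid. $S$ is zero-sum if $\overline{\sigma}(S)=0$, and irreducible if $S\ne 1$, $S$ is zero-sum, and $S$ has no nontrivial proper zero-sum subsequence. An irreducible factorization of a zero-sum indexed sequence $S$ is a way of writing $S=\prod_{i\le m}S_i$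 with all $S_i$ irreducible, up to the order of the factors. $S$ is a unique factorization indexed sequence (UFIS) if it is zero-sum and has exactly one irreducible factorization (in particular the empty sequence $1$ is a UFIS). The cross number of $S$ is $\mathsf{k}(S)=\sum_{g\in G^\bullet}\overline{v}_g(S)/\mathrm{ord}(g)$, and $$\mathsf{K}_1(G)=\max\{\mathsf{k}(S): S \text{ a UFIS over } G\}.$$ *)

theory Defs
  imports
    "HOL-Algebra.Multiplicative_Group"
    "HOL-Algebra.Product_Groups"
    "HOL-Computational_Algebra.Primes"
begin

(* Groups are HOL-Algebra groups, hence written multiplicatively: \<one> is the zero element,
   g [^] n is the n-fold multiple n g, and finprod is the sum. The definitions are meant for
   finite abelian G (on an infinite carrier finprod and sum degenerate).

   The free abelian monoid on a set X consists of the finite multisets with elements in X: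
   {#} is the identity, + the multiplication, \<subseteq># divisibility. *)

definition indexed_sequence :: "('a, 'b) monoid_scheme \<Rightarrow> ('a \<times> nat) multiset \<Rightarrow> bool" where
  "indexed_sequence G S \<longleftrightarrow>
     set_mset S \<subseteq> (carrier G - {\<one>\<^bsub>G\<^esub>}) \<times> UNIV \<and> (\<forall>x. count S x \<le> 1)"

definition valuation :: "'a \<Rightarrow> ('a \<times> nat) multiset \<Rightarrow> nat" where
  "valuation g S = size {# x \<in># S. fst x = g #}"

definition seq_sum :: "('a, 'b) monoid_scheme \<Rightarrow> ('a \<times> nat) multiset \<Rightarrow> 'a" where
  "seq_sum G S = finprod G (\<lambda>g. g [^]\<^bsub>G\<^esub> valuation g S) (carrier G - {\<one>\<^bsub>G\<^esub>})"

definition zero_sum :: "('a, 'b) monoid_scheme \<Rightarrow> ('a \<times> nat) multiset \<Rightarrow> bool" where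
  "zero_sum G S \<longleftrightarrow> seq_sum G S = \<one>\<^bsub>G\<^esub>"

definition irreducible_seq :: "('a, 'b) monoid_scheme \<Rightarrow> ('a \<times> nat) multiset \<Rightarrow> bool" where
  "irreducible_seq G S \<longleftrightarrow>
     indexed_sequence G S \<and> S \<noteq> {#} \<and> zero_sum G S \<and>
     \<not> (\<exists>T. T \<subseteq># S \<and> T \<noteq> {#} \<and> T \<noteq> S \<and> zero_sum G T)"

(* A product of irreducibles up to the order of the factors is a multiset of irreducibles. *)
definition irreducible_factorization ::
  "('a, 'b) monoid_scheme \<Rightarrow> ('a \<times> nat) multiset \<Rightarrow> ('a \<times> nat) multiset multiset \<Rightarrow> bool" where
  "irreducible_factorization G S F \<longleftrightarrow> (\<forall>T \<in># F. irreducible_seq G T) \<and> sum_mset F = S"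

definition UFIS :: "('a, 'b) monoid_scheme \<Rightarrow> ('a \<times> nat) multiset \<Rightarrow> bool" where
  "UFIS G S \<longleftrightarrow>
     indexed_sequence G S \<and> zero_sum G S \<and> (\<exists>!F. irreducible_factorization G S F)"

definition cross_number :: "('a, 'b) monoid_scheme \<Rightarrow> ('a \<times> nat) multiset \<Rightarrow> real" where
  "cross_number G S =
     (\<Sum>g \<in> carrier G - {\<one>\<^bsub>G\<^esub>}. real (valuation g S) / real (group.ord G g))"

(* For finite abelian G infinitely many UFIS exist as soon as G is nontrivial (labels are
   arbitrary), but only finitely many cross numbers occur: two different irreducible factors of
   a UFIS cannot share a group element g, since exchanging two copies of g would yield another
   factorization. So this is a genuine maximum. *)
definition K1 :: "('a, 'b) monoid_scheme \<Rightarrow> real" where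
  "K1 G = Max {cross_number G S | S. UFIS G S}"

(* C_{p^(a 1)} \<oplus> ... \<oplus> C_{p^(a r)} *)
definition cyclic_p_sum :: "nat \<Rightarrow> nat \<Rightarrow> (nat \<Rightarrow> nat) \<Rightarrow> (nat \<Rightarrow> int) monoid" where
  "cyclic_p_sum p r a = product_group {1..r} (\<lambda>i. integer_mod_group (p ^ a i))"

end

theory Submission
  imports Defs
begin

text \<open>
  Write \<open>G\<close> for the smaller group, \<open>H\<close> for the larger one and \<open>n = p ^ \<alpha>
  1\<close>. Multiplying the first coordinate by \<open>p\<close> embeds \<open>G\<close> into \<open>H\<close>
  as the kernel of a character \<open>\<chi>\<close> onto the cyclic group of order \<open>p\<close>. As
  \<open>\<alpha> 1\<close> is the largest exponent, elements of the kernel have order at most \<open>n\<close>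
  and all other elements of \<open>H\<close> have order exactly \<open>p * n\<close>. The formula \<open>K1 H =
  K1 G + 1 / n\<close> holds for every such extension (locale \<open>prime_index_embedding\<close>).

  A zero-sum indexed sequence has a unique factorization iff its zero-sum subsequences are closed under
  intersection: both say that the zero-sum subsequences are exactly the unions of some of the irreducible
  factors. In this form (\<open>unique_factoring\<close>) labels and multisets disappear, and one can replace a
  subsequence with nonzero sum by the single term that is its sum (\<open>unique_factoring_merge\<close>): the
  zero-sum subsequences of the new sequence are those of the old one that contain the replaced block or avoid
  it.

  Upper bound (\<open>family_cross_le\<close>). Consider the block of terms outside the kernel. As long as some
  \<open>p\<close> or fewer of them have a sum that lies in the kernel and is nonzero, merge them: this removes
  cross number at most \<open>p / (p * n) = 1 / n\<close> and adds a term of order at most \<open>n\<close>, so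
  the cross number does not drop. When no such merge is left, irreducible zero-sum sequences over the quotient
  having length at most \<open>p\<close>, every subsequence of the block whose \<open>\<chi>\<close>-image is
  zero-sum is itself zero-sum. Hence the block is a unique factorization sequence over the group of order
  \<open>p\<close>, and such a sequence has at most \<open>p\<close> terms
  (\<open>unique_factoring_card_le_order\<close>): if its factors have lengths \<open>k\<^sub>1, \<dots>,
  k\<^sub>m\<close>, then adding up one proper prefix of each factor gives \<open>k\<^sub>1 \<cdots>
  k\<^sub>m\<close> distinct group elements, and \<open>k\<^sub>1 + \<cdots> + k\<^sub>m \<le> k\<^sub>1
  \<cdots> k\<^sub>m\<close> because all \<open>k\<^sub>i \<ge> 2\<close>. The block thus contributes at most
  \<open>1 / n\<close>, and the rest is a unique factorization sequence over \<open>G\<close>.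

  Lower bound (\<open>family_cross_add_le_K1\<close>). To an optimal sequence over \<open>G\<close> add \<open>p
  - 1\<close> copies of some \<open>e\<close> outside the kernel and the term \<open>(1 - p) e\<close>. All
  \<open>p\<close> new terms have the same nonzero image under \<open>\<chi>\<close>, so a zero-sum subsequence
  contains all of them or none, and they form one new factor of cross number \<open>p / (p * n)\<close>.
\<close>

section \<open>Zero-sum families with unique factorization\<close>

text \<open>The family \<open>w\<close> of group elements, indexed by \<open>X\<close>, stands for an indexed sequence; sub-families are
  subsets of \<open>X\<close>. That this closure property is unique factorization is the
  content of \<open>UFIS_imp_unique_factoring\<close> and \<open>unique_factoring_imp_UFIS\<close> below. Arbitrary index types
  let one form merged and disjoint families without choosing labels.\<close>
definition unique_factoring :: "('a, 'b) monoid_scheme \<Rightarrow> ('i \<Rightarrow> 'a) \<Rightarrow> 'i set \<Rightarrow> bool" where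
  "unique_factoring G w X \<longleftrightarrow>
     finite X \<and> w ` X \<subseteq> carrier G - {\<one>\<^bsub>G\<^esub>} \<and> finprod G w X = \<one>\<^bsub>G\<^esub> \<and>
     (\<forall>T \<subseteq> X. \<forall>U \<subseteq> X. finprod G w T = \<one>\<^bsub>G\<^esub> \<longrightarrow> finprod G w U = \<one>\<^bsub>G\<^esub> \<longrightarrow>
        finprod G w (T \<inter> U) = \<one>\<^bsub>G\<^esub>)"

definition family_cross :: "('a, 'b) monoid_scheme \<Rightarrow> ('i \<Rightarrow> 'a) \<Rightarrow> 'i set \<Rightarrow> real" where
  "family_cross G w X = (\<Sum>x\<in>X. 1 / real (group.ord G (w x)))"

definition zero_sum_atom :: "('a, 'b) monoid_scheme \<Rightarrow> ('i \<Rightarrow> 'a) \<Rightarrow> 'i set \<Rightarrow> bool" where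
  "zero_sum_atom G w U \<longleftrightarrow>
     U \<noteq> {} \<and> finprod G w U = \<one>\<^bsub>G\<^esub> \<and>
     (\<forall>T \<subseteq> U. finprod G w T = \<one>\<^bsub>G\<^esub> \<longrightarrow> T = {} \<or> T = U)"

lemma zero_sum_atom_exists:
  assumes "finite X" "X \<noteq> {}" "finprod G w X = \<one>\<^bsub>G\<^esub>"
  shows "\<exists>U \<subseteq> X. zero_sum_atom G w U"
  using assms
proof (induction "card X" arbitrary: X rule: less_induct)
  case less
  show ?case
  proof (cases "zero_sum_atom G w X")
    case False
    then obtain T where "T \<subset> X" "T \<noteq> {}" "finprod G w T = \<one>\<^bsub>G\<^esub>"
      using less.prems unfolding zero_sum_atom_def by blast
    with less show ?thesis
      by (meson psubset_card_mono finite_subset order_trans psubset_imp_subset)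
  qed blast
qed

context comm_group
begin

lemma finprod_subset_split:
  assumes "finite X" "w ` X \<subseteq> carrier G" "T \<subseteq> X"
  shows "finprod G w X = finprod G w T \<otimes> finprod G w (X - T)"
proof -
  have "finprod G w (T \<union> (X - T)) = finprod G w T \<otimes> finprod G w (X - T)"
    using assms by (intro finprod_Un_disjoint) (auto intro: finite_subset)
  then show ?thesis using assms(3) by (simp add: Un_absorb1)
qed

lemma finprod_complement_eq_one:
  assumes "finite X" "w ` X \<subseteq> carrier G" "T \<subseteq> X" "finprod G w X = \<one>" "finprod G w T = \<one>"
  shows "finprod G w (X - T) = \<one>"
proof -
  have "finprod G w (X - T) \<in> carrier G"
    using assms by (intro finprod_closed) auto
  then show ?thesis
    using finprod_subset_split[OF assms(1-3)] assms(4,5) by simp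
qed

lemma unique_factoring_subset:
  assumes "unique_factoring G w X" "Y \<subseteq> X" "finprod G w Y = \<one>"
  shows "unique_factoring G w Y"
  using assms unfolding unique_factoring_def
  by (smt (verit) finite_subset image_mono order_trans)

section \<open>The length of a uniquely factoring family\<close>

text \<open>The bound on the number of terms comes from exhibiting many distinct group elements. The
  set of all subset sums is awkward to count, since a difference of subset sums need not be a
  subset sum. Requiring this of the chosen elements makes the construction multiplicative over the
  irreducible factors.\<close>
definition difference_system :: "('i \<Rightarrow> 'a) \<Rightarrow> 'i set \<Rightarrow> 'a set \<Rightarrow> bool" where
  "difference_system w X P \<longleftrightarrow> finite P \<and> P \<subseteq> carrier G \<and>
     (\<forall>a\<in>P. \<forall>b\<in>P. \<exists>D \<subseteq> X. a \<otimes> inv b = finprod G w D)"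

text \<open>The prefix sums of an enumeration of \<open>U\<close>. The difference of a longer and a shorter prefix is
  the sum over an interval; the opposite difference is the sum over its complement because \<open>U\<close> has
  sum zero. Intervals shorter than \<open>U\<close> have nonzero sum, so the \<open>card U\<close> prefix sums are distinct.\<close>
lemma atom_difference_system:
  assumes fin: "finite U" and w: "w ` U \<subseteq> carrier G" and U: "zero_sum_atom G w U"
  obtains P where "difference_system w U P" "card P = card U"
proof -
  define n where "n = card U"
  obtain f where f: "bij_betw f {..<n} U"
    using ex_bij_betw_nat_finite[OF fin] by (auto simp: n_def atLeast0LessThan)
  define s where "s k = finprod G w (f ` {..<k})" for k
  have sub: "f ` {..<k} \<subseteq> U" if "k \<le> n" for k
    using f that by (force simp: bij_betw_def)
  have prod_closed: "finprod G w V \<in> carrier G" if "V \<subseteq> U" for V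
    using w that by (intro finprod_closed) auto
  have s_closed: "s k \<in> carrier G" if "k \<le> n" for k
    using prod_closed[OF sub[OF that]] by (simp add: s_def)
  define V where "V b a = f ` {b..<a}" for a b
  have V_sub: "V b a \<subseteq> U" if "a \<le> n" for a b
    using f that by (force simp: bij_betw_def V_def)
  have forward: "s a = s b \<otimes> finprod G w (V b a)" if "b \<le> a" "a \<le> n" for a b
  proof -
    have "inj_on f {..<n}" using f by (simp add: bij_betw_def)
    then have "f ` {..<a} - f ` {..<b} = f ` ({..<a} - {..<b})"
      using that by (intro inj_on_image_set_diff[symmetric]) auto
    moreover have "{..<a} - {..<b} = {b..<a}" by auto
    moreover have "f ` {..<b} \<subseteq> f ` {..<a}" using that by auto
    moreover have "w ` f ` {..<a} \<subseteq> carrier G" using w sub[OF that(2)] by blast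
    ultimately show ?thesis
      using finprod_subset_split[of "f ` {..<a}" w "f ` {..<b}"]
      by (simp add: s_def V_def)
  qed
  have forward_diff: "s a \<otimes> inv s b = finprod G w (V b a)" if "b \<le> a" "a \<le> n" for a b
    using forward[OF that] s_closed[of b] prod_closed[OF V_sub[OF that(2)], of b] that
    by (simp add: m_comm m_assoc[symmetric] inv_solve_right')
  have s_less: "s a \<noteq> s b" if "b < a" "a < n" for a b
  proof
    assume eq: "s a = s b"
    then have "finprod G w (V b a) = \<one>"
      using forward_diff[of b a] s_closed[of b] that by simp
    moreover have "V b a \<noteq> {}" using that by (simp add: V_def)
    ultimately have "V b a = U"
      using U V_sub[of a b] that by (auto simp: zero_sum_atom_def)
    moreover have "card (V b a) < n"
      using that card_image_le[of "{b..<a}" f] by (simp add: V_def)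
    ultimately show False by (simp add: n_def)
  qed
  have inj: "inj_on s {..<n}"
  proof (rule linorder_inj_onI')
    fix i j assume "i \<in> {..<n}" "j \<in> {..<n}" "i < j"
    then show "s i \<noteq> s j" using s_less[of i j] by auto
  qed
  have "\<exists>D\<subseteq>U. s a \<otimes> inv s b = finprod G w D" if "a < n" "b < n" for a b
  proof (cases "b \<le> a")
    case True
    then show ?thesis using forward_diff[of b a] V_sub[of a b] that by auto
  next
    case False
    then have ba: "s b \<otimes> inv s a = finprod G w (V a b)"
      using forward_diff[of a b] that by auto
    have "s a \<otimes> inv s b = inv (s b \<otimes> inv s a)"
      using s_closed that by (simp add: inv_mult_group)
    also have "\<dots> = finprod G w (U - V a b)"
      unfolding ba
      using finprod_subset_split[OF fin w V_sub[of b a]] U that prod_closed[OF V_sub[of b a]]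
        prod_closed[of "U - V a b"]
      by (metis Diff_subset inv_equality less_imp_le m_comm zero_sum_atom_def)
    finally show ?thesis by blast
  qed
  then have "difference_system w U (s ` {..<n})"
    using s_closed by (auto simp: difference_system_def)
  moreover have "card (s ` {..<n}) = card U"
    using inj by (simp add: card_image n_def)
  ultimately show ?thesis using that by blast
qed

text \<open>The bound by the group order on the Davenport constant.\<close>
lemma atom_card_le_order:
  assumes "finite (carrier G)" "finite U" "w ` U \<subseteq> carrier G" "zero_sum_atom G w U"
  shows "card U \<le> order G"
  by (metis assms atom_difference_system card_mono difference_system_def order_def)

text \<open>The products of elements of \<open>P\<close> and \<open>Q\<close> are distinct: a collision yields a zero-sum family
  \<open>D \<union> E\<close> with \<open>D\<close> inside the zero-sum family \<open>U\<close> and \<open>E\<close> disjoint from it, and intersecting with \<open>U\<close> shows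
  that \<open>D\<close> alone is zero-sum.\<close>
lemma difference_system_product:
  assumes X: "unique_factoring G w X" and UY: "U \<subseteq> X" "finprod G w U = \<one>"
    and P: "difference_system w U P" and Q: "difference_system w (X - U) Q"
  obtains R where "difference_system w X R" "card R = card P * card Q"
proof -
  have fin: "finite X" and w: "w ` X \<subseteq> carrier G"
    using X by (auto simp: unique_factoring_def)
  have prod_closed: "finprod G w V \<in> carrier G" if "V \<subseteq> X" for V
    using w that by (intro finprod_closed) auto
  have disj: "finprod G w (D \<union> E) = finprod G w D \<otimes> finprod G w E"
    if "D \<subseteq> U" "E \<subseteq> X - U" for D E
  proof (rule finprod_Un_disjoint)
    have "D \<subseteq> X" "E \<subseteq> X" using that UY by auto
    then show "finite D" "finite E" "w \<in> D \<rightarrow> carrier G" "w \<in> E \<rightarrow> carrier G"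
      using fin w by (auto intro: finite_subset)
    show "D \<inter> E = {}" using that by auto
  qed
  define m where "m = (\<lambda>(a, b). a \<otimes> b)"
  have closed: "P \<subseteq> carrier G" "Q \<subseteq> carrier G"
    using P Q by (auto simp: difference_system_def)
  have P_diff: "\<exists>D\<subseteq>U. a \<otimes> inv b = finprod G w D" if "a \<in> P" "b \<in> P" for a b
    using P that unfolding difference_system_def by blast
  have Q_diff: "\<exists>E\<subseteq>X - U. a \<otimes> inv b = finprod G w E" if "a \<in> Q" "b \<in> Q" for a b
    using Q that unfolding difference_system_def by blast
  have "inj_on m (P \<times> Q)"
  proof (rule inj_onI, clarify)
    fix a b a' b'
    assume *: "a \<in> P" "b \<in> Q" "a' \<in> P" "b' \<in> Q" and eq: "m (a, b) = m (a', b')"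
    then have c: "a \<in> carrier G" "b \<in> carrier G" "a' \<in> carrier G" "b' \<in> carrier G"
      using closed by auto
    obtain D where D: "D \<subseteq> U" "a' \<otimes> inv a = finprod G w D"
      using P_diff * by blast
    obtain E where E: "E \<subseteq> X - U" "b' \<otimes> inv b = finprod G w E"
      using Q_diff * by blast
    have "finprod G w (D \<union> E) = (a' \<otimes> inv a) \<otimes> (b' \<otimes> inv b)"
      using disj[OF D(1) E(1)] D(2) E(2) by simp
    also have "\<dots> = (a' \<otimes> b') \<otimes> inv (a \<otimes> b)"
      using c by (simp add: inv_mult_group m_ac)
    also have "\<dots> = \<one>" using eq c by (simp add: m_def)
    finally have "finprod G w (D \<union> E) = \<one>" .
    moreover have "(D \<union> E) \<inter> U = D" using D E by auto
    moreover have "D \<union> E \<subseteq> X" using UY D E by auto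
    ultimately have "finprod G w D = \<one>"
      using X UY unfolding unique_factoring_def by metis
    then have "a' \<otimes> inv a = \<one>" using D(2) by simp
    then have "a' = \<one> \<otimes> a" using inv_solve_right'[of \<one> a' a] c by simp
    then have "a' = a" using c by simp
    moreover have "b = b'"
      using eq c \<open>a' = a\<close> by (simp add: m_def)
    ultimately show "a = a' \<and> b = b'" by simp
  qed
  then have "card (m ` (P \<times> Q)) = card P * card Q"
    by (simp add: card_image card_cartesian_product)
  moreover have "difference_system w X (m ` (P \<times> Q))"
  proof -
    have "\<exists>D\<subseteq>X. (a \<otimes> b) \<otimes> inv (a' \<otimes> b') = finprod G w D"
      if *: "a \<in> P" "b \<in> Q" "a' \<in> P" "b' \<in> Q" for a b a' b'
    proof -
      have c: "a \<in> carrier G" "b \<in> carrier G" "a' \<in> carrier G" "b' \<in> carrier G"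
        using * closed by auto
      obtain D where D: "D \<subseteq> U" "a \<otimes> inv a' = finprod G w D"
        using P_diff * by blast
      obtain E where E: "E \<subseteq> X - U" "b \<otimes> inv b' = finprod G w E"
        using Q_diff * by blast
      have "(a \<otimes> b) \<otimes> inv (a' \<otimes> b') = (a \<otimes> inv a') \<otimes> (b \<otimes> inv b')"
        using c by (simp add: inv_mult_group m_ac)
      also have "\<dots> = finprod G w (D \<union> E)"
        using disj[OF D(1) E(1)] D(2) E(2) by simp
      finally show ?thesis using D E UY by blast
    qed
    then have "\<forall>x\<in>m ` (P \<times> Q). \<forall>y\<in>m ` (P \<times> Q). \<exists>D\<subseteq>X. x \<otimes> inv y = finprod G w D"
      by (simp add: m_def)
    moreover have "finite (m ` (P \<times> Q))" using P Q by (simp add: difference_system_def)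
    moreover have "m ` (P \<times> Q) \<subseteq> carrier G" using closed by (auto simp: m_def)
    ultimately show ?thesis by (simp add: difference_system_def)
  qed
  ultimately show ?thesis using that by blast
qed

text \<open>If the irreducible factors have lengths \<open>k\<^sub>1, \<dots>, k\<^sub>m\<close>, the construction gives a difference system of
  size \<open>k\<^sub>1 \<cdots> k\<^sub>m\<close>. As no term is zero, each length is at least two, so the product is at least
  the sum. For the empty family the system is \<open>{\<one>}\<close>, and the bound \<open>card P \<ge> 1\<close> keeps
  the product from collapsing when it is one of the two parts.\<close>
lemma unique_factoring_difference_system:
  assumes "unique_factoring G w X"
  shows "\<exists>P. difference_system w X P \<and> card P \<ge> 1 \<and> card P \<ge> card X"
  using assms
proof (induction "card X" arbitrary: X rule: less_induct)
  case less
  have fin: "finite X" and w: "w ` X \<subseteq> carrier G - {\<one>}" and X1: "finprod G w X = \<one>"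
    using less.prems by (auto simp: unique_factoring_def)
  show ?case
  proof (cases "X = {}")
    case True
    then have "difference_system w X {\<one>}" by (auto simp: difference_system_def)
    with True show ?thesis by (intro exI[of _ "{\<one>}"]) auto
  next
    case False
    have card2: "card V \<ge> 2" if "V \<subseteq> X" "V \<noteq> {}" "finprod G w V = \<one>" for V
    proof (rule ccontr)
      assume "\<not> 2 \<le> card V"
      moreover have "card V \<noteq> 0" using that(1,2) fin by (meson card_eq_0_iff finite_subset)
      ultimately have "card V = 1" by linarith
      then obtain x where "V = {x}" by (auto simp: card_1_singleton_iff)
      with that w show False by auto
    qed
    obtain U where U: "U \<subseteq> X" "zero_sum_atom G w U"
      using zero_sum_atom_exists[OF fin False X1] by blast
    have U1: "finprod G w U = \<one>" "U \<noteq> {}" using U by (auto simp: zero_sum_atom_def)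
    obtain P where P: "difference_system w U P" "card P = card U"
      using atom_difference_system[of U w] U fin w finite_subset by blast
    define Y where "Y = X - U"
    have Y1: "finprod G w Y = \<one>"
      unfolding Y_def using finprod_complement_eq_one[of X w U] fin w U U1 X1 by auto
    have card_Y: "card Y = card X - card U"
      unfolding Y_def using U fin by (simp add: card_Diff_subset finite_subset)
    have leX: "card U \<le> card X" using U fin by (simp add: card_mono)
    have U2: "card U \<ge> 2" using card2[OF U(1) U1(2,1)] .
    have "\<exists>Q. difference_system w Y Q \<and> card Q \<ge> 1 \<and> card Q \<ge> card Y"
      using less.hyps[of Y] unique_factoring_subset[OF less.prems, of Y] Y1 card_Y U2 leX
      by (auto simp: Y_def)
    then obtain Q where Q: "difference_system w Y Q" "card Q \<ge> 1" "card Q \<ge> card Y" by blast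
    obtain R where R: "difference_system w X R" "card R = card P * card Q"
      using difference_system_product[OF less.prems U(1) U1(1) P(1)] Q(1) by (auto simp: Y_def)
    \<comment> \<open>a product of two numbers that are at least 2 dominates their sum\<close>
    have "card U + card Y \<le> card U * card Q"
    proof (cases "Y = {}")
      case True
      then show ?thesis using Q(2) by simp
    next
      case False
      then have "card Y \<ge> 2" using card2[of Y] Y1 by (auto simp: Y_def)
      then have q2: "card Q \<ge> 2" using Q by simp
      obtain u q where "card U = 2 + u" "card Q = 2 + q"
        using le_Suc_ex[OF U2] le_Suc_ex[OF q2] by blast
      then show ?thesis using Q(3) by (simp add: algebra_simps)
    qed
    then have "card R \<ge> card X" "card R \<ge> 1"
      using R(2) P(2) Q(2) card_Y leX U2 by auto
    then show ?thesis using R(1) by blast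
  qed
qed

lemma unique_factoring_card_le_order:
  assumes "finite (carrier G)" "unique_factoring G w X"
  shows "card X \<le> order G"
  using unique_factoring_difference_system[OF assms(2)] assms(1)
  by (metis card_mono difference_system_def le_trans order_def)

end

section \<open>Uniquely factoring families and indexed sequences\<close>

lemma valuation_union: "valuation g (S + T) = valuation g S + valuation g T"
  by (simp add: valuation_def)

lemma indexed_sequence_iff:
  "indexed_sequence G S \<longleftrightarrow>
     fst ` set_mset S \<subseteq> carrier G - {\<one>\<^bsub>G\<^esub>} \<and> S = mset_set (set_mset S)"
proof -
  have "S = mset_set (set_mset S) \<longleftrightarrow> (\<forall>x. count S x \<le> 1)"
  proof
    assume "S = mset_set (set_mset S)"
    then have "count S x = count (mset_set (set_mset S)) x" for x by simp
    then show "\<forall>x. count S x \<le> 1" by (simp add: count_mset_set')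
  next
    assume *: "\<forall>x. count S x \<le> 1"
    show "S = mset_set (set_mset S)"
    proof (rule multiset_eqI)
      fix x
      show "count S x = count (mset_set (set_mset S)) x"
        using spec[OF *, of x] count_greater_zero_iff[of S x]
        by (cases "x \<in># S") (simp_all add: count_mset_set' not_in_iff del: count_greater_zero_iff)
    qed
  qed
  then show ?thesis
    unfolding indexed_sequence_def by fastforce
qed

lemma factor_support:
  assumes "irreducible_factorization G (mset_set X) F" "finite X" "M \<in># F"
  shows "set_mset M \<subseteq> X"
proof -
  have "M \<subseteq># sum_mset F" using assms(3) by (simp add: sum_mset.remove)
  then have "set_mset M \<subseteq> set_mset (sum_mset F)" by (rule set_mset_mono)
  moreover have "set_mset (sum_mset F) = X"
    using assms(1,2) unfolding irreducible_factorization_def by (metis finite_set_mset_mset_set)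
  ultimately show ?thesis by simp
qed

text \<open>Split off proper zero-sum divisors until none is left. The complement of a zero-sum divisor is
  zero-sum by cancellation, which is the assumption \<open>diff\<close>.\<close>
lemma irreducible_factorization_exists:
  assumes G: "comm_group G" and "indexed_sequence G S" "zero_sum G S"
    and diff: "\<And>A B. A \<subseteq># B \<Longrightarrow> indexed_sequence G B \<Longrightarrow> zero_sum G A \<Longrightarrow> zero_sum G B \<Longrightarrow> zero_sum G (B - A)"
  shows "\<exists>F. irreducible_factorization G S F"
  using assms(2,3)
proof (induction "size S" arbitrary: S rule: less_induct)
  case less
  consider "S = {#}" | "irreducible_seq G S" | "S \<noteq> {#}" "\<not> irreducible_seq G S" by blast
  then show ?case
  proof cases
    case 1
    then show ?thesis by (intro exI[of _ "{#}"]) (simp add: irreducible_factorization_def)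
  next
    case 2
    then show ?thesis by (intro exI[of _ "{#S#}"]) (simp add: irreducible_factorization_def)
  next
    case 3
    then obtain T where T: "T \<subseteq># S" "T \<noteq> {#}" "T \<noteq> S" "zero_sum G T"
      using less.prems by (auto simp: irreducible_seq_def)
    have sub: "indexed_sequence G A" if "A \<subseteq># S" for A
      using less.prems(1) that unfolding indexed_sequence_def
      by (meson mset_subset_eq_count order_trans set_mset_mono)
    have "size T < size S" using T by (meson mset_subset_size subset_mset.le_imp_less_or_eq)
    moreover have "size (S - T) < size S"
      using T by (simp add: size_Diff_submset nonempty_has_size size_mset_mono diff_less_mono2
          less_le_trans)
    ultimately obtain F1 F2 where "irreducible_factorization G T F1"
      "irreducible_factorization G (S - T) F2"
      using less T sub diff by (metis diff_subset_eq_self)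
    then have "irreducible_factorization G S (F1 + F2)"
      using T(1) by (auto simp: irreducible_factorization_def)
    then show ?thesis by blast
  qed
qed

context comm_group
begin

lemma seq_sum_union:
  "seq_sum G (S + T) = seq_sum G S \<otimes> seq_sum G T"
proof -
  have "seq_sum G (S + T) =
      finprod G (\<lambda>g. g [^] valuation g S \<otimes> g [^] valuation g T) (carrier G - {\<one>})"
    unfolding seq_sum_def by (rule finprod_cong') (auto simp: valuation_union nat_pow_mult)
  also have "\<dots> = seq_sum G S \<otimes> seq_sum G T"
    unfolding seq_sum_def by (rule finprod_multf) auto
  finally show ?thesis .
qed

lemma seq_sum_closed: "seq_sum G S \<in> carrier G"
  unfolding seq_sum_def by (intro finprod_closed) auto

lemma seq_sum_empty: "seq_sum G {#} = \<one>"
  unfolding seq_sum_def by (rule finprod_one_eqI) (simp add: valuation_def)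

lemma seq_sum_singleton:
  assumes "finite (carrier G)" "fst x \<in> carrier G - {\<one>}"
  shows "seq_sum G {#x#} = fst x"
proof -
  have "seq_sum G {#x#} = (\<Otimes>g\<in>carrier G - {\<one>}. if fst x = g then g else \<one>)"
    unfolding seq_sum_def by (rule finprod_cong') (auto simp: valuation_def)
  also have "\<dots> = fst x"
    using assms by (intro finprod_singleton[where f = "\<lambda>g. g"]) auto
  finally show ?thesis .
qed

lemma seq_sum_mset_set:
  assumes "finite (carrier G)" "finite X" "fst ` X \<subseteq> carrier G - {\<one>}"
  shows "seq_sum G (mset_set X) = finprod G fst X"
  using assms(2,3)
proof (induction X rule: finite_induct)
  case empty
  then show ?case by (simp add: seq_sum_empty)
next
  case (insert x X)
  have "seq_sum G (mset_set (insert x X)) = seq_sum G ({#x#} + mset_set X)"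
    using insert by simp
  also have "\<dots> = fst x \<otimes> finprod G fst X"
    using insert assms(1) unfolding seq_sum_union by (simp add: seq_sum_singleton)
  also have "\<dots> = finprod G fst (insert x X)"
    using insert by (intro finprod_insert[symmetric]) auto
  finally show ?case .
qed

lemma cross_number_mset_set:
  assumes "finite (carrier G)" "finite X" "fst ` X \<subseteq> carrier G - {\<one>}"
  shows "cross_number G (mset_set X) = family_cross G fst X"
proof -
  have val: "valuation g (mset_set X) = card {x\<in>X. fst x = g}" for g
    using assms(2) by (simp add: valuation_def filter_mset_mset_set)
  have "family_cross G fst X =
      (\<Sum>g\<in>carrier G - {\<one>}. \<Sum>x\<in>{x\<in>X. fst x = g}. 1 / real (ord (fst x)))"
    unfolding family_cross_def using assms by (intro sum.group[symmetric]) auto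
  also have "\<dots> = cross_number G (mset_set X)"
    unfolding cross_number_def val by (intro sum.cong) auto
  finally show ?thesis ..
qed

lemma zero_sum_diff:
  assumes "A \<subseteq># B" "zero_sum G A" "zero_sum G B"
  shows "zero_sum G (B - A)"
proof -
  have "seq_sum G (A + (B - A)) = seq_sum G A \<otimes> seq_sum G (B - A)"
    by (rule seq_sum_union)
  then show ?thesis
    using assms seq_sum_closed[of "B - A"] by (simp add: zero_sum_def)
qed

lemma zero_sum_sum_mset:
  assumes "\<forall>M\<in>#F. zero_sum G M"
  shows "zero_sum G (sum_mset F)"
  using assms by (induction F) (auto simp: zero_sum_def seq_sum_empty seq_sum_union)

text \<open>Factoring \<open>U\<close> and \<open>X - U\<close> separately gives the unique factorization of \<open>X\<close>, so each of its factors lies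
  in \<open>U\<close> or is disjoint from \<open>U\<close>. The factors of \<open>T\<close> are among them, and those inside \<open>U\<close> make up
  \<open>T \<inter> U\<close>.\<close>
lemma UFIS_imp_unique_factoring:
  assumes fin: "finite (carrier G)" and S: "UFIS G S"
  shows "unique_factoring G fst (set_mset S)"
proof -
  define X where "X = set_mset S"
  have idx: "indexed_sequence G S" and "zero_sum G S"
    and uniq: "\<exists>!F. irreducible_factorization G S F"
    using S by (auto simp: UFIS_def)
  then have X: "S = mset_set X" "finite X" "fst ` X \<subseteq> carrier G - {\<one>}"
    using indexed_sequence_iff[of G S] by (simp_all add: X_def)
  have zs: "zero_sum G (mset_set T) \<longleftrightarrow> finprod G fst T = \<one>" if "T \<subseteq> X" for T
    using that X fin unfolding zero_sum_def
    by (subst seq_sum_mset_set) (auto intro: finite_subset)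
  have sub_idx: "indexed_sequence G (mset_set T)" if "T \<subseteq> X" for T
    using that X finite_subset[OF that X(2)] by (auto simp: indexed_sequence_iff)
  have sub: "mset_set T \<subseteq># S" if "T \<subseteq> X" for T
    using that X by (simp add: subset_imp_msubset_mset_set)
  have fact: "\<exists>F. irreducible_factorization G (mset_set T) F"
    if "T \<subseteq> X" "finprod G fst T = \<one>" for T
    using irreducible_factorization_exists[OF comm_group_axioms sub_idx[OF that(1)]]
      that zs zero_sum_diff by blast
  have "finprod G fst (T \<inter> U) = \<one>"
    if T: "T \<subseteq> X" "finprod G fst T = \<one>" and U: "U \<subseteq> X" "finprod G fst U = \<one>" for T U
  proof -
    have split: "\<exists>F F'. irreducible_factorization G (mset_set V) F \<and>
        irreducible_factorization G (mset_set (X - V)) F' \<and> irreducible_factorization G S (F + F')"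
      if V: "V \<subseteq> X" "finprod G fst V = \<one>" for V
    proof -
      have "finprod G fst (X - V) = \<one>"
        using finprod_complement_eq_one[of X fst V] X V zs[of X] \<open>zero_sum G S\<close> by auto
      then obtain F F' where F: "irreducible_factorization G (mset_set V) F"
        "irreducible_factorization G (mset_set (X - V)) F'"
        using fact[OF V] fact[of "X - V"] by blast
      moreover have "mset_set V + mset_set (X - V) = S"
        using X V by (metis add.commute finite_Diff finite_subset mset_set_Diff
            subset_imp_msubset_mset_set subset_mset.diff_add)
      ultimately have "irreducible_factorization G S (F + F')"
        by (auto simp: irreducible_factorization_def)
      with F show ?thesis by blast
    qed
    obtain FT FT' where FT: "irreducible_factorization G (mset_set T) FT"
      "irreducible_factorization G S (FT + FT')" using split[OF T] by blast
    obtain FU FU' where FU: "irreducible_factorization G (mset_set U) FU"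
      "irreducible_factorization G (mset_set (X - U)) FU'"
      "irreducible_factorization G S (FU + FU')" using split[OF U] by blast
    have eq: "FT + FT' = FU + FU'" using uniq FT(2) FU(3) by blast
    have fins: "finite T" "finite U" using T U X finite_subset by auto
    have dich: "set_mset M \<subseteq> U \<or> set_mset M \<inter> U = {}" if "M \<in># FT" for M
    proof -
      have "M \<in># FU \<or> M \<in># FU'" using that eq by (metis union_iff)
      then show ?thesis
        using factor_support[OF FU(1) fins(2)] factor_support[OF FU(2)] X by blast
    qed
    define R where "R = filter_mset (\<lambda>M. set_mset M \<subseteq> U) FT"
    have "zero_sum G (sum_mset R)"
      using FT(1) unfolding R_def irreducible_factorization_def irreducible_seq_def
      by (intro zero_sum_sum_mset) auto
    moreover have "sum_mset R = mset_set (T \<inter> U)"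
    proof -
      have "sum_mset FT = mset_set T" using FT(1) by (simp add: irreducible_factorization_def)
      moreover have "sum_mset FT = sum_mset R + sum_mset (filter_mset (\<lambda>M. \<not> set_mset M \<subseteq> U) FT)"
        unfolding R_def by (metis multiset_partition sum_mset.union)
      moreover have "filter_mset (\<lambda>x. x \<in> U) (sum_mset R) = sum_mset R"
        unfolding R_def by (auto simp: filter_mset_eq_conv)
      moreover have "filter_mset (\<lambda>x. x \<in> U) (sum_mset (filter_mset (\<lambda>M. \<not> set_mset M \<subseteq> U) FT)) = {#}"
        using dich by (fastforce simp: filter_mset_eq_conv)
      ultimately have "sum_mset R = filter_mset (\<lambda>x. x \<in> U) (mset_set T)"
        by (metis filter_union_mset add.right_neutral)
      also have "\<dots> = mset_set (T \<inter> U)" using fins by (simp add: filter_mset_mset_set Int_def)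
      finally show ?thesis .
    qed
    ultimately show ?thesis using zs[of "T \<inter> U"] T by auto
  qed
  then show ?thesis
    using X zs[of X] \<open>zero_sum G S\<close> unfolding unique_factoring_def X_def[symmetric] by simp
qed

text \<open>A factor \<open>M\<close> of one factorization meets some factor \<open>N\<close> of the other. Their intersection is a nonempty
  zero-sum divisor of both, so irreducibility forces \<open>M = N\<close>. Hence both factorizations have the same
  factors, and none is repeated because \<open>X\<close> is squarefree.\<close>
lemma unique_factoring_imp_UFIS:
  assumes fin: "finite (carrier G)" and X: "unique_factoring G fst X"
  shows "UFIS G (mset_set X)"
proof -
  have fX: "finite X" and w: "fst ` X \<subseteq> carrier G - {\<one>}" and X1: "finprod G fst X = \<one>"
    using X by (auto simp: unique_factoring_def)
  have zs: "zero_sum G (mset_set T) \<longleftrightarrow> finprod G fst T = \<one>" if "T \<subseteq> X" for T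
    using that fX w fin unfolding zero_sum_def
    by (subst seq_sum_mset_set) (auto intro: finite_subset)
  have idx: "indexed_sequence G (mset_set X)" using fX w by (simp add: indexed_sequence_iff)
  have zX: "zero_sum G (mset_set X)" using zs X1 by blast
  obtain F0 where F0: "irreducible_factorization G (mset_set X) F0"
    using irreducible_factorization_exists[OF comm_group_axioms idx zX] zero_sum_diff by blast
  have member: "M = mset_set (set_mset M)" "set_mset M \<subseteq> X" "set_mset M \<noteq> {}" "irreducible_seq G M"
    if "irreducible_factorization G (mset_set X) F" "M \<in># F" for F M
  proof -
    show "irreducible_seq G M" using that by (auto simp: irreducible_factorization_def)
    then show "M = mset_set (set_mset M)" "set_mset M \<noteq> {}"
      by (auto simp: irreducible_seq_def indexed_sequence_iff)
    show "set_mset M \<subseteq> X" using factor_support[OF that(1) fX that(2)] .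
  qed
  have incl: "M \<in># F'"
    if F: "irreducible_factorization G (mset_set X) F" and M: "M \<in># F"
      and F': "irreducible_factorization G (mset_set X) F'" for F F' M
  proof -
    obtain x where x: "x \<in># M" using member[OF F M] by auto
    then have "x \<in># sum_mset F'"
      using member(2)[OF F M] fX F' by (auto simp: irreducible_factorization_def)
    then obtain N where N: "N \<in># F'" "x \<in># N" by auto
    define V where "V = set_mset M \<inter> set_mset N"
    have "finprod G fst V = \<one>"
    proof -
      have "finprod G fst (set_mset M) = \<one>" "finprod G fst (set_mset N) = \<one>"
        using member[OF F M] member[OF F' N(1)] zs[of "set_mset M"] zs[of "set_mset N"]
        by (auto simp: irreducible_seq_def)
      then show ?thesis
        using X member(2)[OF F M] member(2)[OF F' N(1)] unfolding V_def unique_factoring_def by blast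
    qed
    then have zV: "zero_sum G (mset_set V)"
      using zs[of V] member(2)[OF F M] by (auto simp: V_def)
    have V_eq: "mset_set V = K" if "V \<subseteq> set_mset K" "K = mset_set (set_mset K)" "irreducible_seq G K" for K
    proof -
      have "mset_set V \<subseteq># K"
        using that(1) by (subst that(2)) (simp add: subset_imp_msubset_mset_set)
      moreover have "mset_set V \<noteq> {#}"
        using x N by (auto simp: V_def mset_set_empty_iff)
      ultimately show ?thesis using that(3) zV unfolding irreducible_seq_def by blast
    qed
    have "mset_set V = M" "mset_set V = N"
      using V_eq member[OF F M] member[OF F' N(1)] by (auto simp: V_def)
    then show ?thesis using N by simp
  qed
  have count1: "count F M \<le> 1" if F: "irreducible_factorization G (mset_set X) F" for F M
  proof (rule ccontr)
    assume "\<not> count F M \<le> 1"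
    then have c: "count F M \<ge> 2" by simp
    then have M: "M \<in># F" by (metis count_greater_zero_iff less_le_trans pos2)
    obtain x where x: "x \<in># M" using member[OF F M] by auto
    have "M \<in># F - {#M#}"
      using c by (simp add: in_diff_count)
    then have "sum_mset F = M + (M + sum_mset (F - {#M#} - {#M#}))"
      using M by (metis sum_mset.remove)
    moreover have "sum_mset F = mset_set X" using F by (simp add: irreducible_factorization_def)
    ultimately have "count (mset_set X) x = count M x + (count M x + count (sum_mset (F - {#M#} - {#M#})) x)"
      by (metis count_union)
    moreover have "count M x \<ge> 1" using x by simp
    ultimately have "count (mset_set X) x \<ge> 2" by linarith
    then show False by (simp add: count_mset_set' split: if_splits)
  qed
  have "F = F0" if F: "irreducible_factorization G (mset_set X) F" for F
  proof (rule multiset_eqI)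
    fix M
    have "M \<in># F \<longleftrightarrow> M \<in># F0" using incl F F0 by blast
    then show "count F M = count F0 M"
      using count1[OF F, of M] count1[OF F0, of M]
      by (metis count_greater_eq_one_iff le_antisym not_in_iff)
  qed
  with F0 idx zX show ?thesis unfolding UFIS_def by blast
qed

end

section \<open>Change of index set and of group\<close>

lemma unique_factoring_reindex:
  assumes "comm_group G" "inj_on h X" "(w \<circ> h) ` X \<subseteq> carrier G"
  shows "unique_factoring G w (h ` X) \<longleftrightarrow> unique_factoring G (w \<circ> h) X"
proof -
  interpret comm_group G by fact
  have prod: "finprod G w (h ` T) = finprod G (w \<circ> h) T" if "T \<subseteq> X" for T
    using assms(2,3) that unfolding comp_def
    by (intro finprod_reindex) (auto intro: inj_on_subset)
  have int: "h ` T \<inter> h ` U = h ` (T \<inter> U)" if "T \<subseteq> X" "U \<subseteq> X" for T U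
    using inj_on_image_Int[OF assms(2) that] by simp
  show ?thesis
    unfolding unique_factoring_def all_subset_image
    using assms(2) by (simp add: prod int finite_image_iff image_comp le_infI1 cong: conj_cong imp_cong)
qed

lemma family_cross_reindex:
  "inj_on h X \<Longrightarrow> family_cross G w (h ` X) = family_cross G (w \<circ> h) X"
  by (simp add: family_cross_def sum.reindex)

lemma finprod_hom:
  assumes "comm_group G" "comm_group H" "h \<in> hom G H" "w ` X \<subseteq> carrier G"
  shows "h (finprod G w X) = finprod H (h \<circ> w) X"
proof -
  interpret G: comm_group G by fact
  interpret H: comm_group H by fact
  interpret group_hom G H h using assms(3) by unfold_locales
  show ?thesis
    using assms(4)
  proof (induction X rule: infinite_finite_induct)
    case (insert x X)
    then have "w \<in> X \<rightarrow> carrier G" "w x \<in> carrier G" by auto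
    moreover from this have "(\<lambda>a. h (w a)) \<in> X \<rightarrow> carrier H" by (simp add: Pi_iff)
    ultimately show ?case using insert by simp
  qed auto
qed

lemma unique_factoring_hom:
  assumes "comm_group G" "comm_group H" "h \<in> hom G H" "inj_on h (carrier G)" "w ` X \<subseteq> carrier G"
  shows "unique_factoring H (h \<circ> w) X \<longleftrightarrow> unique_factoring G w X"
proof -
  interpret G: comm_group G by fact
  interpret H: comm_group H by fact
  interpret group_hom G H h using assms(3) by unfold_locales
  have one: "h a = \<one>\<^bsub>H\<^esub> \<longleftrightarrow> a = \<one>\<^bsub>G\<^esub>" if "a \<in> carrier G" for a
    using assms(4) that by (metis G.one_closed hom_one inj_on_def)
  have prod: "finprod H (h \<circ> w) T = \<one>\<^bsub>H\<^esub> \<longleftrightarrow> finprod G w T = \<one>\<^bsub>G\<^esub>" if "T \<subseteq> X" for T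
  proof -
    have "w ` T \<subseteq> carrier G" using that assms(5) by blast
    moreover from this have "finprod G w T \<in> carrier G" by (intro G.finprod_closed) auto
    ultimately show ?thesis using one by (simp add: finprod_hom[OF assms(1-3), symmetric])
  qed
  have "(h \<circ> w) ` X \<subseteq> carrier H - {\<one>\<^bsub>H\<^esub>} \<longleftrightarrow> w ` X \<subseteq> carrier G - {\<one>\<^bsub>G\<^esub>}"
  proof -
    have "w x \<in> carrier G" if "x \<in> X" for x using assms(5) that by auto
    then show ?thesis using one by fastforce
  qed
  then show ?thesis
    unfolding unique_factoring_def by (simp add: prod le_infI1 cong: conj_cong imp_cong)
qed

lemma ord_hom_inj:
  assumes "group G" "group H" "h \<in> hom G H" "inj_on h (carrier G)" "a \<in> carrier G"
  shows "group.ord H (h a) = group.ord G a"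
proof -
  interpret G: group G by fact
  interpret H: group H by fact
  interpret group_hom G H h using assms(3) by unfold_locales
  have "h a [^]\<^bsub>H\<^esub> k = \<one>\<^bsub>H\<^esub> \<longleftrightarrow> a [^]\<^bsub>G\<^esub> k = \<one>\<^bsub>G\<^esub>" for k :: nat
    using assms(4,5) by (metis G.nat_pow_closed G.one_closed hom_nat_pow hom_one inj_on_def)
  then have "h a [^]\<^bsub>H\<^esub> k = \<one>\<^bsub>H\<^esub> \<longleftrightarrow> G.ord a dvd k" for k :: nat
    using G.pow_eq_id assms(5) by simp
  then show ?thesis using H.ord_unique[of "h a" "G.ord a"] assms(5) by simp
qed

section \<open>The constant K1 as an attained maximum\<close>

context comm_group
begin

text \<open>With \<open>N = order G\<close>, a cross number is an integer divided by \<open>N\<close>, since all element orders divide \<open>N\<close>;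
  the integer is at most \<open>N * N\<close>, as a uniquely factoring family has at most \<open>N\<close> terms.\<close>
lemma finite_UFIS_cross_numbers:
  assumes fin: "finite (carrier G)"
  shows "finite {cross_number G S | S. UFIS G S}"
proof -
  define N where "N = order G"
  have N: "N > 0" using fin order_gt_0_iff_finite by (simp add: N_def)
  have "cross_number G S \<in> (\<lambda>k. real k / real N) ` {..N * N}" if S: "UFIS G S" for S
  proof -
    define X where "X = set_mset S"
    have X: "unique_factoring G fst X"
      using UFIS_imp_unique_factoring[OF fin S] by (simp add: X_def)
    then have w: "fst ` X \<subseteq> carrier G - {\<one>}" "finite X" by (auto simp: unique_factoring_def)
    have "S = mset_set X" using S by (simp add: X_def UFIS_def indexed_sequence_iff)
    then have "cross_number G S = (\<Sum>x\<in>X. 1 / real (ord (fst x)))"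
      using cross_number_mset_set[OF fin w(2,1)] by (simp add: family_cross_def)
    also have "\<dots> = (\<Sum>x\<in>X. real (N div ord (fst x)) / real N)"
    proof (rule sum.cong[OF refl])
      fix x assume "x \<in> X"
      then have "ord (fst x) dvd N" "fst x \<in> carrier G"
        using w ord_dvd_group_order by (auto simp: N_def)
      then show "1 / real (ord (fst x)) = real (N div ord (fst x)) / real N"
        using N by (auto simp: real_of_nat_div field_simps)
    qed
    also have "\<dots> = real (\<Sum>x\<in>X. N div ord (fst x)) / real N"
      by (simp add: sum_divide_distrib)
    finally have eq: "cross_number G S = real (\<Sum>x\<in>X. N div ord (fst x)) / real N" .
    have "(\<Sum>x\<in>X. N div ord (fst x)) \<le> card X * N"
      using sum_bounded_above[of X "\<lambda>x. N div ord (fst x)" N] by simp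
    also have "\<dots> \<le> N * N"
      using unique_factoring_card_le_order[OF fin X] by (simp add: N_def)
    finally show ?thesis using eq by blast
  qed
  then show ?thesis by (intro finite_subset[OF _ finite_imageI[OF finite_atMost]]) auto
qed

lemma K1_attained:
  assumes fin: "finite (carrier G)"
  obtains X :: "('a \<times> nat) set" where "unique_factoring G fst X" "K1 G = family_cross G fst X"
proof -
  have "unique_factoring G fst {}" by (simp add: unique_factoring_def)
  then have "{cross_number G S | S. UFIS G S} \<noteq> {}"
    using unique_factoring_imp_UFIS[OF fin, of "{}"] by blast
  then have "K1 G \<in> {cross_number G S | S. UFIS G S}"
    unfolding K1_def using finite_UFIS_cross_numbers[OF fin] by (intro Max_in)
  then obtain S where S: "UFIS G S" "K1 G = cross_number G S" by blast
  have X: "unique_factoring G fst (set_mset S)"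
    using UFIS_imp_unique_factoring[OF fin S(1)] .
  moreover have "S = mset_set (set_mset S)" using S by (simp add: UFIS_def indexed_sequence_iff)
  then have "K1 G = family_cross G fst (set_mset S)"
    using cross_number_mset_set[OF fin, of "set_mset S"] X S(2) by (simp add: unique_factoring_def)
  ultimately show ?thesis using that by blast
qed

text \<open>Distinct labels turn a family with any index set into an indexed sequence.\<close>
lemma family_cross_le_K1:
  assumes fin: "finite (carrier G)" and X: "unique_factoring G w X"
  shows "family_cross G w X \<le> K1 G"
proof -
  have fX: "finite X" and w: "w ` X \<subseteq> carrier G" using X by (auto simp: unique_factoring_def)
  obtain f :: "_ \<Rightarrow> nat" where f: "inj_on f X" using finite_imp_inj_to_nat_seg[OF fX] by blast
  define h where "h x = (w x, f x)" for x
  have h: "inj_on h X" using f by (auto simp: h_def inj_on_def)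
  have comp: "fst \<circ> h = w" by (auto simp: h_def)
  define Z where "Z = h ` X"
  have Z: "unique_factoring G fst Z"
    using unique_factoring_reindex[OF comm_group_axioms h, of fst] X w by (simp add: comp Z_def)
  have "family_cross G w X = family_cross G fst Z"
    using family_cross_reindex[OF h, of G fst] by (simp add: comp Z_def)
  also have "\<dots> = cross_number G (mset_set Z)"
    using cross_number_mset_set[OF fin, of Z] Z by (simp add: unique_factoring_def)
  also have "\<dots> \<le> K1 G"
    unfolding K1_def using finite_UFIS_cross_numbers[OF fin] unique_factoring_imp_UFIS[OF fin Z]
    by (intro Max_ge) auto
  finally show ?thesis .
qed

section \<open>Merging terms\<close>

text \<open>The index \<open>u\<close> is reused for the merged term. Expanding this term back into \<open>U\<close> (the map \<open>E\<close>
  below) preserves sums and commutes with intersections.\<close>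
lemma unique_factoring_merge:
  assumes X: "unique_factoring G w X" and U: "U \<subseteq> X" "u \<in> U" "finprod G w U \<noteq> \<one>"
  shows "unique_factoring G (w(u := finprod G w U)) (insert u (X - U))"
proof -
  define w' where "w' = w(u := finprod G w U)"
  define Z where "Z = insert u (X - U)"
  define E where "E T = (if u \<in> T then T \<union> U else T)" for T
  have fin: "finite X" and w: "w ` X \<subseteq> carrier G - {\<one>}" and X1: "finprod G w X = \<one>"
    using X by (auto simp: unique_factoring_def)
  have closed: "finprod G w V \<in> carrier G" if "V \<subseteq> X" for V
    using w that by (intro finprod_closed) auto
  have E_sub: "E T \<subseteq> X" if "T \<subseteq> Z" for T using that U by (auto simp: E_def Z_def)
  have prod: "finprod G w' T = finprod G w (E T)" if T: "T \<subseteq> Z" for T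
  proof (cases "u \<in> T")
    case True
    have rest: "T - {u} \<subseteq> X - U" using T by (auto simp: Z_def)
    then have same: "finprod G w' (T - {u}) = finprod G w (T - {u})"
      using w by (intro finprod_cong') (auto simp: w'_def)
    have "finite (T - {u})" using rest fin finite_subset by blast
    then have "finprod G w' (insert u (T - {u})) = w' u \<otimes> finprod G w' (T - {u})"
      using rest w closed[OF U(1)] by (intro finprod_insert) (auto simp: w'_def)
    also have "\<dots> = finprod G w U \<otimes> finprod G w (T - {u})"
      unfolding same by (simp add: w'_def)
    also have "\<dots> = finprod G w (U \<union> (T - {u}))"
      using rest U fin w by (intro finprod_Un_disjoint[symmetric]) (auto intro: finite_subset)
    also have "U \<union> (T - {u}) = E T" using True U by (auto simp: E_def)
    finally show ?thesis using True by (simp add: insert_absorb)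
  next
    case False
    then have "T \<subseteq> X" using T by (auto simp: Z_def)
    then have "finprod G w' T = finprod G w T"
      using w False by (intro finprod_cong') (auto simp: w'_def)
    then show ?thesis using False by (simp add: E_def)
  qed
  have inter: "E (S \<inter> T) = E S \<inter> E T" if "S \<subseteq> Z" "T \<subseteq> Z" for S T
    using that U(2) by (auto simp: E_def Z_def)
  have "E Z = X" using U by (auto simp: E_def Z_def)
  then have "finprod G w' Z = \<one>" using prod[of Z] X1 by simp
  moreover have "finite Z" using fin by (simp add: Z_def)
  moreover have "w' ` Z \<subseteq> carrier G - {\<one>}"
    using w U(3) closed[OF U(1)] by (auto simp: w'_def Z_def)
  moreover have "finprod G w' (S \<inter> T) = \<one>"
    if "S \<subseteq> Z" "T \<subseteq> Z" "finprod G w' S = \<one>" "finprod G w' T = \<one>" for S T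
  proof -
    have "finprod G w (E S \<inter> E T) = \<one>"
      using X E_sub[OF that(1)] E_sub[OF that(2)] that prod unfolding unique_factoring_def by metis
    then show ?thesis using prod[of "S \<inter> T"] inter that by auto
  qed
  ultimately show ?thesis
    unfolding unique_factoring_def w'_def[symmetric] Z_def[symmetric] by blast
qed

end

section \<open>Extensions by a group of prime order\<close>

text \<open>An exact sequence \<open>G \<rightarrow> H \<rightarrow> Q\<close> with \<open>\<iota>\<close> injective. The two conditions on orders ensure that \<open>p\<close> terms
  outside the image of \<open>G\<close> have together at most the cross number of any single term inside it.\<close>
locale prime_index_embedding =
  G: comm_group G + H: comm_group H + Q: comm_group Q
  for G :: "('a, 'm) monoid_scheme" and H :: "('b, 'n) monoid_scheme"
    and Q :: "('c, 'l) monoid_scheme" +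
  fixes \<iota> :: "'a \<Rightarrow> 'b" and \<chi> :: "'b \<Rightarrow> 'c" and p n :: nat
  assumes finite_G: "finite (carrier G)" and finite_H: "finite (carrier H)"
    and \<iota>_hom: "\<iota> \<in> hom G H" and \<iota>_inj: "inj_on \<iota> (carrier G)"
    and \<chi>_hom: "\<chi> \<in> hom H Q" and \<chi>_nontrivial: "\<exists>y\<in>carrier H. \<chi> y \<noteq> \<one>\<^bsub>Q\<^esub>"
    and exact: "\<iota> ` carrier G = {y \<in> carrier H. \<chi> y = \<one>\<^bsub>Q\<^esub>}"
    and prime_p: "prime p" and order_Q: "order Q = p"
    and n_pos: "n > 0" and exponent_G: "\<And>x. x \<in> carrier G \<Longrightarrow> x [^]\<^bsub>G\<^esub> n = \<one>\<^bsub>G\<^esub>"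
    and ord_outside: "\<And>y. y \<in> carrier H \<Longrightarrow> \<chi> y \<noteq> \<one>\<^bsub>Q\<^esub> \<Longrightarrow> group.ord H y = p * n"
begin

lemma p_pos: "p > 0" using prime_p by (rule prime_gt_0_nat)

lemma finite_Q: "finite (carrier Q)"
  using order_Q p_pos Q.order_gt_0_iff_finite by simp

lemma ord_kernel:
  assumes "y \<in> carrier H" "\<chi> y = \<one>\<^bsub>Q\<^esub>"
  shows "0 < H.ord y" "H.ord y \<le> n"
proof -
  obtain x where x: "x \<in> carrier G" "y = \<iota> x" using assms exact by blast
  then have "H.ord y dvd n"
    using ord_hom_inj[OF _ _ \<iota>_hom \<iota>_inj x(1)] exponent_G[OF x(1)] G.pow_eq_id[OF x(1)]
      G.group_axioms H.group_axioms by simp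
  then show "0 < H.ord y" "H.ord y \<le> n" using n_pos by (auto dest: dvd_imp_le dvd_pos_nat)
qed

lemma kernel_cross_le_K1:
  assumes X: "unique_factoring H w X" and ker: "\<And>x. x \<in> X \<Longrightarrow> \<chi> (w x) = \<one>\<^bsub>Q\<^esub>"
  shows "family_cross H w X \<le> K1 G"
proof -
  define v where "v = inv_into (carrier G) \<iota> \<circ> w"
  have w: "w x \<in> \<iota> ` carrier G" if "x \<in> X" for x
    using X ker that exact by (auto simp: unique_factoring_def)
  then have v: "v ` X \<subseteq> carrier G" "\<And>x. x \<in> X \<Longrightarrow> \<iota> (v x) = w x"
    by (auto simp: v_def inv_into_into f_inv_into_f)
  have wX: "w ` X \<subseteq> carrier H" using X by (auto simp: unique_factoring_def)
  have prod: "finprod H (\<iota> \<circ> v) T = finprod H w T" if "T \<subseteq> X" for T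
    using that v(2) wX by (intro H.finprod_cong') auto
  have "unique_factoring H (\<iota> \<circ> v) X"
    using X v(2) unfolding unique_factoring_def
    by (simp add: prod le_infI1 image_subset_iff cong: conj_cong imp_cong)
  then have "unique_factoring G v X"
    using unique_factoring_hom[OF _ _ \<iota>_hom \<iota>_inj v(1)] G.comm_group_axioms H.comm_group_axioms
    by blast
  then have "family_cross G v X \<le> K1 G" by (rule G.family_cross_le_K1[OF finite_G])
  moreover have "family_cross G v X = family_cross H w X"
    unfolding family_cross_def
  proof (rule sum.cong[OF refl])
    fix x assume "x \<in> X"
    then show "1 / real (G.ord (v x)) = 1 / real (H.ord (w x))"
      using ord_hom_inj[OF _ _ \<iota>_hom \<iota>_inj, of "v x"] v G.group_axioms H.group_axioms by force
  qed
  ultimately show ?thesis by simp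
qed

text \<open>Induction on the number of terms outside the kernel. Either some of them can be merged without
  lowering the cross number, or they form a uniquely factoring family over \<open>Q\<close>.\<close>
lemma family_cross_le:
  assumes "unique_factoring H w X"
  shows "family_cross H w X \<le> K1 G + 1 / real n"
  using assms
proof (induction "card {x \<in> X. \<chi> (w x) \<noteq> \<one>\<^bsub>Q\<^esub>}" arbitrary: w X rule: less_induct)
  case less
  define B where "B = {x \<in> X. \<chi> (w x) \<noteq> \<one>\<^bsub>Q\<^esub>}"
  have fin: "finite X" and w: "w ` X \<subseteq> carrier H - {\<one>\<^bsub>H\<^esub>}" and X1: "finprod H w X = \<one>\<^bsub>H\<^esub>"
    using less.prems by (auto simp: unique_factoring_def)
  have B: "B \<subseteq> X" "finite B" using fin by (auto simp: B_def)
  have closed: "finprod H w T \<in> carrier H" if "T \<subseteq> X" for T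
    using w that by (intro H.finprod_closed) auto
  have \<chi>_prod: "\<chi> (finprod H w T) = finprod Q (\<chi> \<circ> w) T" if "T \<subseteq> X" for T
    using that w
    by (intro finprod_hom[OF H.comm_group_axioms Q.comm_group_axioms \<chi>_hom]) auto
  have ord_B: "H.ord (w x) = p * n" if "x \<in> B" for x
    using that w by (intro ord_outside) (auto simp: B_def)
  have cross_B: "family_cross H w U = real (card U) / (real p * real n)" if "U \<subseteq> B" for U
  proof -
    have "family_cross H w U = (\<Sum>x\<in>U. 1 / (real p * real n))"
      unfolding family_cross_def using that ord_B by (intro sum.cong) auto
    then show ?thesis by simp
  qed
  have cross_B_le: "family_cross H w U \<le> 1 / real n" if "U \<subseteq> B" "card U \<le> p" for U
    unfolding cross_B[OF that(1)] using that(2) p_pos n_pos by (simp add: field_simps)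
  have cross_split: "family_cross H w X = family_cross H w U + family_cross H w (X - U)"
    if "U \<subseteq> X" for U
    unfolding family_cross_def using sum.subset_diff[OF that fin, of "\<lambda>x. 1 / real (H.ord (w x))"] by simp
  show ?case
  proof (cases "\<exists>U\<subseteq>B. U \<noteq> {} \<and> card U \<le> p \<and> \<chi> (finprod H w U) = \<one>\<^bsub>Q\<^esub> \<and> finprod H w U \<noteq> \<one>\<^bsub>H\<^esub>")
    case True
    then obtain U u where U: "U \<subseteq> B" "u \<in> U" "card U \<le> p"
      "\<chi> (finprod H w U) = \<one>\<^bsub>Q\<^esub>" "finprod H w U \<noteq> \<one>\<^bsub>H\<^esub>" by blast
    define s where "s = finprod H w U"
    define Z where "Z = insert u (X - U)"
    have UX: "U \<subseteq> X" using U B by blast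
    have Z: "unique_factoring H (w(u := s)) Z"
      unfolding s_def Z_def using H.unique_factoring_merge[OF less.prems UX U(2,5)] .
    have "{x \<in> Z. \<chi> ((w(u := s)) x) \<noteq> \<one>\<^bsub>Q\<^esub>} \<subset> B"
      using U by (auto simp: Z_def B_def s_def)
    then have "card {x \<in> Z. \<chi> ((w(u := s)) x) \<noteq> \<one>\<^bsub>Q\<^esub>} < card B"
      using B(2) by (rule psubset_card_mono[rotated])
    then have IH: "family_cross H (w(u := s)) Z \<le> K1 G + 1 / real n"
      using less.hyps Z unfolding B_def by blast
    have s: "0 < H.ord s" "H.ord s \<le> n"
      using ord_kernel[of s] closed[OF UX] U(4) by (auto simp: s_def)
    have "family_cross H w U \<le> 1 / real (H.ord s)"
      using cross_B_le[OF U(1,3)] s by (smt (verit) frac_le of_nat_0_less_iff of_nat_mono)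
    moreover have "family_cross H (w(u := s)) Z = 1 / real (H.ord s) + family_cross H w (X - U)"
    proof -
      have "family_cross H (w(u := s)) Z
          = 1 / real (H.ord s) + family_cross H (w(u := s)) (X - U)"
        using fin U(2) by (simp add: family_cross_def Z_def)
      also have "family_cross H (w(u := s)) (X - U) = family_cross H w (X - U)"
        unfolding family_cross_def using U(2) by (intro sum.cong) auto
      finally show ?thesis .
    qed
    ultimately show ?thesis using IH cross_split[OF UX] by linarith
  next
    case False
    then have small: "finprod H w U = \<one>\<^bsub>H\<^esub>"
      if "U \<subseteq> B" "U \<noteq> {}" "card U \<le> p" "\<chi> (finprod H w U) = \<one>\<^bsub>Q\<^esub>" for U
      using that by blast
    have wQ: "(\<chi> \<circ> w) ` T \<subseteq> carrier Q" if "T \<subseteq> X" for T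
      using that w \<chi>_hom by (auto simp: hom_def Pi_iff)
    \<comment> \<open>irreducible zero-sum families over \<open>Q\<close> have at most \<open>p\<close> terms, so \<open>small\<close> applies to each
      irreducible factor of \<open>T\<close> over \<open>Q\<close>\<close>
    have lift: "finprod H w T = \<one>\<^bsub>H\<^esub>" if "T \<subseteq> B" "finprod Q (\<chi> \<circ> w) T = \<one>\<^bsub>Q\<^esub>" for T
      using that
    proof (induction "card T" arbitrary: T rule: less_induct)
      case (less T)
      have fT: "finite T" and TX: "T \<subseteq> X" using less.prems B finite_subset by blast+
      show ?case
      proof (cases "T = {}")
        case False
        then obtain U where U: "U \<subseteq> T" "zero_sum_atom Q (\<chi> \<circ> w) U"
          using zero_sum_atom_exists[OF fT False less.prems(2)] by blast
        have UX: "U \<subseteq> X" and fU: "finite U" using U TX fT finite_subset by blast+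
        have U': "U \<noteq> {}" "finprod Q (\<chi> \<circ> w) U = \<one>\<^bsub>Q\<^esub>" using U(2) by (auto simp: zero_sum_atom_def)
        have "card U \<le> p"
          using Q.atom_card_le_order[OF finite_Q fU wQ[OF UX] U(2)] order_Q by simp
        then have U1: "finprod H w U = \<one>\<^bsub>H\<^esub>"
          using small[of U] U U' less.prems \<chi>_prod[OF UX] by auto
        have "card (T - U) < card T" using U U'(1) fT by (intro psubset_card_mono) auto
        moreover have "finprod Q (\<chi> \<circ> w) (T - U) = \<one>\<^bsub>Q\<^esub>"
          using Q.finprod_complement_eq_one[OF fT wQ[OF TX] U(1) less.prems(2) U'(2)] .
        ultimately have "finprod H w (T - U) = \<one>\<^bsub>H\<^esub>"
          using less.hyps less.prems(1) by blast
        moreover have "w ` T \<subseteq> carrier H" using w TX by blast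
        ultimately show ?thesis
          using H.finprod_subset_split[OF fT _ U(1), of w] U1 by simp
      qed simp
    qed
    have iff: "finprod Q (\<chi> \<circ> w) T = \<one>\<^bsub>Q\<^esub> \<longleftrightarrow> finprod H w T = \<one>\<^bsub>H\<^esub>" if "T \<subseteq> B" for T
    proof
      assume "finprod H w T = \<one>\<^bsub>H\<^esub>"
      then have "finprod Q (\<chi> \<circ> w) T = \<chi> \<one>\<^bsub>H\<^esub>" using \<chi>_prod[of T] that B by auto
      then show "finprod Q (\<chi> \<circ> w) T = \<one>\<^bsub>Q\<^esub>"
        using hom_one[OF \<chi>_hom H.group_axioms Q.group_axioms] by simp
    qed (use lift that in blast)
    have "finprod Q (\<chi> \<circ> w) (X - B) = \<one>\<^bsub>Q\<^esub>"
      by (rule Q.finprod_one_eqI) (auto simp: B_def)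
    moreover have "finprod Q (\<chi> \<circ> w) X = \<one>\<^bsub>Q\<^esub>"
      using \<chi>_prod[of X] X1 hom_one[OF \<chi>_hom H.group_axioms Q.group_axioms] by simp
    ultimately have B1: "finprod Q (\<chi> \<circ> w) B = \<one>\<^bsub>Q\<^esub>"
      using Q.finprod_complement_eq_one[OF fin wQ[of X], of "X - B"] B(1)
      by (simp add: double_diff)
    have "unique_factoring Q (\<chi> \<circ> w) B"
    proof -
      have "finprod Q (\<chi> \<circ> w) (T \<inter> U) = \<one>\<^bsub>Q\<^esub>"
        if "T \<subseteq> B" "U \<subseteq> B" "finprod Q (\<chi> \<circ> w) T = \<one>\<^bsub>Q\<^esub>" "finprod Q (\<chi> \<circ> w) U = \<one>\<^bsub>Q\<^esub>" for T U
      proof -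
        have "finprod H w (T \<inter> U) = \<one>\<^bsub>H\<^esub>"
          using less.prems lift[of T] lift[of U] that B(1) unfolding unique_factoring_def
          by (meson order_trans)
        then show ?thesis using iff[of "T \<inter> U"] that by auto
      qed
      moreover have "(\<chi> \<circ> w) ` B \<subseteq> carrier Q - {\<one>\<^bsub>Q\<^esub>}"
        using wQ[OF B(1)] by (auto simp: B_def)
      ultimately show ?thesis using B(2) B1 by (simp add: unique_factoring_def)
    qed
    then have "card B \<le> p"
      using Q.unique_factoring_card_le_order[OF finite_Q] order_Q by auto
    then have "family_cross H w B \<le> 1 / real n" using cross_B_le[of B] by simp
    moreover have "family_cross H w (X - B) \<le> K1 G"
    proof (rule kernel_cross_le_K1)
      have "finprod H w (X - B) = \<one>\<^bsub>H\<^esub>"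
        using H.finprod_complement_eq_one[OF fin _ B(1) X1 lift[OF _ B1]] w by auto
      then show "unique_factoring H w (X - B)"
        by (intro H.unique_factoring_subset[OF less.prems]) auto
    qed (auto simp: B_def)
    ultimately show ?thesis using cross_split[OF B(1)] by linarith
  qed
qed

text \<open>The new family is the disjoint union of the image \<open>A\<close> of the old one and a block \<open>C\<close> of \<open>p\<close> terms that
  lie in one coset of the kernel, so that no proper nonempty part of \<open>C\<close> can be completed to a
  zero-sum family by terms of \<open>A\<close>.\<close>
lemma family_cross_add_le_K1:
  assumes X: "unique_factoring G v X"
  shows "family_cross G v X + 1 / real n \<le> K1 H"
proof -
  obtain e where e: "e \<in> carrier H" "\<chi> e \<noteq> \<one>\<^bsub>Q\<^esub>" using \<chi>_nontrivial by blast
  define c where "c = \<chi> e"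
  have c: "c \<in> carrier Q" "c \<noteq> \<one>\<^bsub>Q\<^esub>" using e \<chi>_hom by (auto simp: c_def hom_def)
  have "Q.ord c dvd p" using Q.ord_dvd_group_order[OF c(1)] order_Q by simp
  moreover have "Q.ord c \<noteq> 1" using Q.ord_eq_1[OF c(1)] c(2) by simp
  ultimately have ord_c: "Q.ord c = p" using prime_p by (auto simp: prime_nat_iff)
  interpret \<chi>: group_hom H Q \<chi> using \<chi>_hom by unfold_locales
  interpret \<iota>: group_hom G H \<iota> using \<iota>_hom by unfold_locales
  define e' where "e' = inv\<^bsub>H\<^esub> (e [^]\<^bsub>H\<^esub> (p - 1))"
  have e': "e' \<in> carrier H" using e by (simp add: e'_def)
  have p1: "Suc (p - 1) = p" using p_pos by simp
  have \<chi>e': "\<chi> e' = c"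
  proof -
    have "c \<otimes>\<^bsub>Q\<^esub> c [^]\<^bsub>Q\<^esub> (p - 1) = c [^]\<^bsub>Q\<^esub> p"
      using c(1) p1 Q.nat_pow_Suc2[of c "p - 1"] by simp
    also have "\<dots> = \<one>\<^bsub>Q\<^esub>" using Q.pow_ord_eq_1[OF c(1)] ord_c by simp
    finally have "inv\<^bsub>Q\<^esub> (c [^]\<^bsub>Q\<^esub> (p - 1)) = c" using c(1) by (intro Q.inv_equality) auto
    then show ?thesis using e by (simp add: e'_def c_def \<chi>.hom_nat_pow)
  qed
  define w where "w = case_sum (\<iota> \<circ> v) (\<lambda>i::nat. if i = 0 then e' else e)"
  define A where "A = (Inl ` X :: ('d + nat) set)"
  define C where "C = (Inr ` {..<p} :: ('d + nat) set)"
  have fX: "finite X" and vX: "v ` X \<subseteq> carrier G" using X by (auto simp: unique_factoring_def)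
  have A: "unique_factoring H w A"
  proof -
    have "w \<circ> Inl = \<iota> \<circ> v" by (auto simp: w_def)
    moreover have "(w \<circ> Inl) ` X \<subseteq> carrier H" using vX by (auto simp: w_def)
    moreover have "unique_factoring H (\<iota> \<circ> v) X"
      using unique_factoring_hom[OF G.comm_group_axioms H.comm_group_axioms \<iota>_hom \<iota>_inj vX] X by simp
    ultimately show ?thesis
      unfolding A_def using unique_factoring_reindex[OF H.comm_group_axioms, of Inl X w] by simp
  qed
  have \<chi>A: "\<chi> (w x) = \<one>\<^bsub>Q\<^esub>" if "x \<in> A" for x
  proof -
    have "w x \<in> \<iota> ` carrier G" using that vX by (auto simp: A_def w_def)
    then show ?thesis using exact by simp
  qed
  have \<chi>C: "\<chi> (w x) = c" if "x \<in> C" for x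
    using that \<chi>e' by (auto simp: C_def w_def c_def)
  have fin: "finite A" "finite C" using fX by (auto simp: A_def C_def)
  have wA: "w ` A \<subseteq> carrier H - {\<one>\<^bsub>H\<^esub>}" using A by (simp add: unique_factoring_def)
  have wC: "w ` C \<subseteq> carrier H - {\<one>\<^bsub>H\<^esub>}"
  proof -
    have "w x \<in> carrier H - {\<one>\<^bsub>H\<^esub>}" if "x \<in> C" for x
    proof -
      have "w x \<in> carrier H" using that e(1) e' by (auto simp: C_def w_def)
      moreover have "w x \<noteq> \<one>\<^bsub>H\<^esub>" using \<chi>C[OF that] c(2) \<chi>.hom_one by metis
      ultimately show ?thesis by simp
    qed
    then show ?thesis by (rule image_subsetI)
  qed
  have C1: "finprod H w C = \<one>\<^bsub>H\<^esub>"
  proof -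
    have "finprod H w C = finprod H (w \<circ> Inr) {..<p}"
      unfolding C_def comp_def using wC by (intro H.finprod_reindex) (auto simp: C_def)
    also have "{..<p} = insert 0 {1..<p}" using p_pos by auto
    also have "finprod H (w \<circ> Inr) (insert 0 {1..<p}) = e' \<otimes>\<^bsub>H\<^esub> finprod H (w \<circ> Inr) {1..<p}"
      using e e' by (subst H.finprod_insert) (auto simp: w_def)
    also have "finprod H (w \<circ> Inr) {1..<p} = finprod H (\<lambda>_. e) {1..<p}"
      using e by (intro H.finprod_cong') (auto simp: w_def)
    also have "\<dots> = e [^]\<^bsub>H\<^esub> (p - 1)" unfolding H.finprod_const[OF e(1)] by simp
    finally show ?thesis using e by (simp add: e'_def)
  qed
  define Z where "Z = A \<union> C"
  have disj: "A \<inter> C = {}" by (auto simp: A_def C_def)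
  have split: "finprod H w T = finprod H w (T \<inter> A) \<otimes>\<^bsub>H\<^esub> finprod H w (T \<inter> C)" if "T \<subseteq> Z" for T
  proof -
    have "finprod H w ((T \<inter> A) \<union> (T \<inter> C)) = finprod H w (T \<inter> A) \<otimes>\<^bsub>H\<^esub> finprod H w (T \<inter> C)"
      using fin disj wA wC by (intro H.finprod_Un_disjoint) auto
    moreover have "(T \<inter> A) \<union> (T \<inter> C) = T" using that by (auto simp: Z_def)
    ultimately show ?thesis by simp
  qed
  \<comment> \<open>the image in \<open>Q\<close> of the sum over \<open>T\<close> is \<open>card (T \<inter> C)\<close> times an element of order \<open>p\<close>\<close>
  have all_or_none: "T \<inter> C = {} \<or> T \<inter> C = C" if T: "T \<subseteq> Z" "finprod H w T = \<one>\<^bsub>H\<^esub>" for T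
  proof -
    have cl: "finprod H w (T \<inter> A) \<in> carrier H" "finprod H w (T \<inter> C) \<in> carrier H"
      using wA wC by (auto intro!: H.finprod_closed)
    have "\<chi> (finprod H w (T \<inter> A)) = finprod Q (\<chi> \<circ> w) (T \<inter> A)"
      using wA by (intro finprod_hom[OF H.comm_group_axioms Q.comm_group_axioms \<chi>_hom]) auto
    also have "\<dots> = \<one>\<^bsub>Q\<^esub>" using \<chi>A by (intro Q.finprod_one_eqI) auto
    finally have a: "\<chi> (finprod H w (T \<inter> A)) = \<one>\<^bsub>Q\<^esub>" .
    have "\<chi> (finprod H w (T \<inter> C)) = finprod Q (\<chi> \<circ> w) (T \<inter> C)"
      using wC by (intro finprod_hom[OF H.comm_group_axioms Q.comm_group_axioms \<chi>_hom]) auto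
    also have "\<dots> = finprod Q (\<lambda>_. c) (T \<inter> C)"
      using \<chi>C c by (intro Q.finprod_cong') auto
    also have "\<dots> = c [^]\<^bsub>Q\<^esub> card (T \<inter> C)" by (rule Q.finprod_const[OF c(1)])
    finally have "\<chi> (finprod H w T) = c [^]\<^bsub>Q\<^esub> card (T \<inter> C)"
      unfolding split[OF T(1)] using a cl c(1) by simp
    then have "c [^]\<^bsub>Q\<^esub> card (T \<inter> C) = \<one>\<^bsub>Q\<^esub>" using T(2) by simp
    then have "p dvd card (T \<inter> C)" using Q.pow_eq_id[OF c(1)] ord_c by simp
    moreover have "card C = p" by (simp add: C_def card_image)
    ultimately have "card (T \<inter> C) = 0 \<or> card (T \<inter> C) \<ge> card C"
      by (metis dvd_imp_le gr0I)
    then show ?thesis using fin(2) card_seteq[OF fin(2), of "T \<inter> C"] by auto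
  qed
  have zs: "finprod H w T = \<one>\<^bsub>H\<^esub> \<longleftrightarrow>
      (T \<inter> C = {} \<or> T \<inter> C = C) \<and> finprod H w (T \<inter> A) = \<one>\<^bsub>H\<^esub>" if "T \<subseteq> Z" for T
  proof -
    have "finprod H w (T \<inter> A) \<in> carrier H" using wA by (auto intro!: H.finprod_closed)
    then have "finprod H w T = finprod H w (T \<inter> A)" if "T \<inter> C = {} \<or> T \<inter> C = C"
      using split[OF \<open>T \<subseteq> Z\<close>] that C1 by auto
    then show ?thesis using all_or_none[OF that] by auto
  qed
  have "unique_factoring H w Z"
  proof -
    have "finprod H w (S \<inter> T) = \<one>\<^bsub>H\<^esub>"
      if *: "S \<subseteq> Z" "T \<subseteq> Z" "finprod H w S = \<one>\<^bsub>H\<^esub>" "finprod H w T = \<one>\<^bsub>H\<^esub>" for S T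
    proof -
      have "finprod H w ((S \<inter> A) \<inter> (T \<inter> A)) = \<one>\<^bsub>H\<^esub>"
        using A zs * unfolding unique_factoring_def by (meson inf_le2)
      moreover have "(S \<inter> A) \<inter> (T \<inter> A) = S \<inter> T \<inter> A" by auto
      moreover have "S \<inter> T \<inter> C = {} \<or> S \<inter> T \<inter> C = C" using zs[OF *(1)] zs[OF *(2)] * by blast
      ultimately show ?thesis using zs[of "S \<inter> T"] * by auto
    qed
    moreover have "Z \<inter> A = A" "Z \<inter> C = C" by (auto simp: Z_def)
    then have "finprod H w Z = \<one>\<^bsub>H\<^esub>" using zs[of Z] A by (simp add: unique_factoring_def)
    ultimately show ?thesis
      using fin wA wC unfolding unique_factoring_def by (auto simp: Z_def)
  qed
  then have "family_cross H w Z \<le> K1 H" by (rule H.family_cross_le_K1[OF finite_H])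
  moreover have "family_cross H w Z = family_cross H w A + family_cross H w C"
    unfolding family_cross_def Z_def using fin disj by (intro sum.union_disjoint)
  moreover have "family_cross H w A = family_cross G v X"
  proof -
    have "family_cross H w A = family_cross H (w \<circ> Inl) X"
      unfolding A_def by (rule family_cross_reindex) simp
    also have "\<dots> = family_cross G v X"
      unfolding family_cross_def
    proof (rule sum.cong[OF refl])
      fix x assume "x \<in> X"
      then have "H.ord (\<iota> (v x)) = G.ord (v x)"
        using vX by (intro ord_hom_inj[OF G.group_axioms H.group_axioms \<iota>_hom \<iota>_inj]) auto
      then show "1 / real (H.ord ((w \<circ> Inl) x)) = 1 / real (G.ord (v x))" by (simp add: w_def)
    qed
    finally show ?thesis .
  qed
  moreover have "family_cross H w C = 1 / real n"
  proof -
    have "H.ord (w x) = p * n" if "x \<in> C" for x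
      using that wC \<chi>C c(2) by (intro ord_outside) auto
    then have "family_cross H w C = (\<Sum>x\<in>C. 1 / real (p * n))" by (simp add: family_cross_def)
    also have "\<dots> = real p * (1 / real (p * n))" by (simp add: C_def card_image)
    finally show ?thesis using p_pos by simp
  qed
  ultimately show ?thesis by simp
qed

theorem K1_eq: "K1 H = K1 G + 1 / real n"
proof (rule antisym)
  obtain X :: "('b \<times> nat) set" where "unique_factoring H fst X" "K1 H = family_cross H fst X"
    using H.K1_attained[OF finite_H] by blast
  then show "K1 H \<le> K1 G + 1 / real n" using family_cross_le by simp
next
  obtain X :: "('a \<times> nat) set" where "unique_factoring G fst X" "K1 G = family_cross G fst X"
    using G.K1_attained[OF finite_G] by blast
  then show "K1 G + 1 / real n \<le> K1 H" using family_cross_add_le_K1 by simp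
qed

end

section \<open>Direct sums of cyclic p-groups\<close>

lemma cyclic_p_sum_simps:
  assumes "p > 0"
  shows "carrier (cyclic_p_sum p r a) = (\<Pi>\<^sub>E i\<in>{1..r}. {0..<int (p ^ a i)})"
    and "\<one>\<^bsub>cyclic_p_sum p r a\<^esub> = (\<lambda>i\<in>{1..r}. 0)"
    and "x \<otimes>\<^bsub>cyclic_p_sum p r a\<^esub> y = (\<lambda>i\<in>{1..r}. (x i + y i) mod int (p ^ a i))"
  using assms by (simp_all add: cyclic_p_sum_def carrier_integer_mod_group cong: restrict_cong)

lemma comm_group_cyclic_p_sum: "comm_group (cyclic_p_sum p r a)"
proof (rule group.group_comm_groupI)
  show "group (cyclic_p_sum p r a)" by (simp add: cyclic_p_sum_def)
  show "x \<otimes>\<^bsub>cyclic_p_sum p r a\<^esub> y = y \<otimes>\<^bsub>cyclic_p_sum p r a\<^esub> x" for x y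
    by (simp add: cyclic_p_sum_def add.commute)
qed

lemma finite_cyclic_p_sum: "p > 0 \<Longrightarrow> finite (carrier (cyclic_p_sum p r a))"
  by (simp add: cyclic_p_sum_simps finite_PiE)

lemma cyclic_p_sum_pow:
  assumes "p > 0" "x \<in> carrier (cyclic_p_sum p r a)"
  shows "x [^]\<^bsub>cyclic_p_sum p r a\<^esub> (k::nat) = (\<lambda>i\<in>{1..r}. (int k * x i) mod int (p ^ a i))"
proof (induction k)
  case 0
  show ?case by (simp add: cyclic_p_sum_simps[OF assms(1)])
next
  case (Suc k)
  show ?case
    unfolding nat_pow_Suc Suc cyclic_p_sum_simps(3)[OF assms(1)]
    by (rule restrict_ext) (simp add: mod_simps algebra_simps)
qed

lemma cyclic_p_sum_pow_eq_one:
  assumes "p > 0" "x \<in> carrier (cyclic_p_sum p r a)" "\<And>i. i \<in> {1..r} \<Longrightarrow> a i \<le> b"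
  shows "x [^]\<^bsub>cyclic_p_sum p r a\<^esub> (p ^ b) = \<one>\<^bsub>cyclic_p_sum p r a\<^esub>"
proof -
  have "(int (p ^ b) * x i) mod int (p ^ a i) = 0" if "i \<in> {1..r}" for i
    using assms(3)[OF that] by (simp add: le_imp_power_dvd)
  then show ?thesis
    unfolding cyclic_p_sum_pow[OF assms(1,2)] cyclic_p_sum_simps(2)[OF assms(1)]
    by (intro restrict_ext) simp
qed

theorem proposition16:
  fixes p r :: nat and \<alpha> :: "nat \<Rightarrow> nat"
  assumes "prime p"
    and "r \<ge> 1"
    and "\<forall>i \<in> {2..r}. \<alpha> 1 \<ge> \<alpha> i"
  shows "K1 (cyclic_p_sum p r (\<alpha>(1 := \<alpha> 1 + 1))) = K1 (cyclic_p_sum p r \<alpha>) + 1 / real (p ^ \<alpha> 1)"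
proof -
  define \<beta> where "\<beta> = \<alpha>(1 := \<alpha> 1 + 1)"
  define G where "G = cyclic_p_sum p r \<alpha>"
  define H where "H = cyclic_p_sum p r \<beta>"
  define \<iota> :: "(nat \<Rightarrow> int) \<Rightarrow> nat \<Rightarrow> int" where
    "\<iota> x = (\<lambda>i\<in>{1..r}. if i = 1 then int p * x i else x i)" for x
  define \<chi> :: "(nat \<Rightarrow> int) \<Rightarrow> int" where "\<chi> x = x 1 mod int p" for x
  have p: "p > 0" using assms(1) prime_gt_0_nat by blast
  have p1: "p > 1" using assms(1) prime_gt_1_nat by blast
  have r1: "1 \<in> {1..r}" using assms(2) by simp
  have \<alpha>_le: "\<alpha> i \<le> \<alpha> 1" if "i \<in> {1..r}" for i
    using assms(3) that by (cases "i = 1") auto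
  have \<beta>_le: "\<beta> i \<le> Suc (\<alpha> 1)" if "i \<in> {1..r}" for i
    using \<alpha>_le[OF that] by (auto simp: \<beta>_def)
  note G_simps = cyclic_p_sum_simps[OF p, of r \<alpha>, folded G_def]
  note H_simps = cyclic_p_sum_simps[OF p, of r \<beta>, folded H_def]
  interpret G: comm_group G unfolding G_def by (rule comm_group_cyclic_p_sum)
  interpret H: comm_group H unfolding H_def by (rule comm_group_cyclic_p_sum)
  interpret Q: comm_group "integer_mod_group p" by simp
  have \<iota>_closed: "\<iota> x \<in> carrier H" if "x \<in> carrier G" for x
  proof -
    have x: "0 \<le> x i" "x i < int (p ^ \<alpha> i)" if "i \<in> {1..r}" for i
      using that \<open>x \<in> carrier G\<close> by (auto simp: G_simps PiE_iff)
    then show ?thesis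
      using p r1 by (auto simp: H_simps \<iota>_def \<beta>_def)
  qed
  have \<iota>_hom: "\<iota> \<in> hom G H"
  proof (rule homI)
    fix x y
    show "\<iota> (x \<otimes>\<^bsub>G\<^esub> y) = \<iota> x \<otimes>\<^bsub>H\<^esub> \<iota> y"
      unfolding G_simps(3) H_simps(3) \<iota>_def
      by (rule restrict_ext) (auto simp: \<beta>_def mult_mod_right distrib_left)
  qed (rule \<iota>_closed)
  have \<iota>_inj: "inj_on \<iota> (carrier G)"
  proof (rule inj_onI)
    fix x y assume xy: "x \<in> carrier G" "y \<in> carrier G" "\<iota> x = \<iota> y"
    show "x = y"
    proof (rule PiE_ext)
      show "x \<in> (\<Pi>\<^sub>E i\<in>{1..r}. {0..<int (p ^ \<alpha> i)})" "y \<in> (\<Pi>\<^sub>E i\<in>{1..r}. {0..<int (p ^ \<alpha> i)})"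
        using xy by (simp_all only: G_simps)
      fix i assume "i \<in> {1..r}"
      then show "x i = y i"
        using fun_cong[OF xy(3), of i] p by (auto simp: \<iota>_def split: if_splits)
    qed
  qed
  have p_dvd: "int p dvd int (p ^ \<beta> 1)" by (simp add: \<beta>_def)
  have \<chi>_hom: "\<chi> \<in> hom H (integer_mod_group p)"
  proof (rule homI)
    show "\<chi> x \<in> carrier (integer_mod_group p)" for x
      using p by (simp add: \<chi>_def carrier_integer_mod_group)
    show "\<chi> (x \<otimes>\<^bsub>H\<^esub> y) = \<chi> x \<otimes>\<^bsub>integer_mod_group p\<^esub> \<chi> y" for x y
      using r1 mod_mod_cancel[OF p_dvd] by (simp add: \<chi>_def H_simps mod_add_eq)
  qed
  have exact: "\<iota> ` carrier G = {y \<in> carrier H. \<chi> y = 0}"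
  proof (intro equalityI subsetI)
    fix y assume "y \<in> \<iota> ` carrier G"
    then show "y \<in> {y \<in> carrier H. \<chi> y = 0}"
      using \<iota>_closed r1 by (auto simp: \<chi>_def \<iota>_def)
  next
    fix y assume "y \<in> {y \<in> carrier H. \<chi> y = 0}"
    then have y: "y \<in> carrier H" and "int p dvd y 1" by (auto simp: \<chi>_def)
    then obtain k where k: "y 1 = int p * k" by blast
    have y1: "0 \<le> y i" "y i < int (p ^ \<beta> i)" if "i \<in> {1..r}" for i
      using that y by (auto simp: H_simps PiE_iff)
    have y2: "y i < int (p ^ \<alpha> i)" if "i \<in> {1..r}" "i \<noteq> 1" for i
      using y1(2)[OF that(1)] that(2) by (simp add: \<beta>_def)
    have "0 \<le> k" using y1(1)[OF r1] p k by (simp add: zero_le_mult_iff)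
    moreover have "k < int (p ^ \<alpha> 1)" using y1(2)[OF r1] p k by (simp add: \<beta>_def)
    moreover have "y \<in> extensional {1..r}" using y by (simp add: H_simps PiE_iff)
    ultimately have "y = \<iota> (y(1 := k))" "y(1 := k) \<in> carrier G"
      using y1(1) y2 k r1
      by (auto simp: \<iota>_def G_simps PiE_iff extensional_def \<beta>_def fun_eq_iff split: if_splits)
    then show "y \<in> \<iota> ` carrier G" by blast
  qed
  interpret prime_index_embedding G H "integer_mod_group p" \<iota> \<chi> p "p ^ \<alpha> 1"
  proof
    show "finite (carrier G)" "finite (carrier H)"
      using finite_cyclic_p_sum[OF p] by (simp_all add: G_def H_def)
    show "\<iota> \<in> hom G H" "inj_on \<iota> (carrier G)" "\<chi> \<in> hom H (integer_mod_group p)"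
      by (fact \<iota>_hom \<iota>_inj \<chi>_hom)+
    show "\<iota> ` carrier G = {y \<in> carrier H. \<chi> y = \<one>\<^bsub>integer_mod_group p\<^esub>}" using exact by simp
    show "prime p" by fact
    show "order (integer_mod_group p) = p" using p by (simp add: order_def carrier_integer_mod_group)
    show "p ^ \<alpha> 1 > 0" using p by simp
    show "x [^]\<^bsub>G\<^esub> (p ^ \<alpha> 1) = \<one>\<^bsub>G\<^esub>" if "x \<in> carrier G" for x
      using cyclic_p_sum_pow_eq_one[OF p] that \<alpha>_le by (simp add: G_def)
    show "\<exists>y\<in>carrier H. \<chi> y \<noteq> \<one>\<^bsub>integer_mod_group p\<^esub>"
    proof
      have "1 < p ^ \<beta> 1" using one_less_power[OF p1, of "\<beta> 1"] by (simp add: \<beta>_def)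
      then have "1 < int (p ^ \<beta> 1)" by linarith
      then show "(\<lambda>i\<in>{1..r}. if i = 1 then 1 else 0) \<in> carrier H"
        using p by (auto simp: H_simps)
      show "\<chi> (\<lambda>i\<in>{1..r}. if i = 1 then 1 else 0) \<noteq> \<one>\<^bsub>integer_mod_group p\<^esub>"
        using r1 p1 by (simp add: \<chi>_def)
    qed
    fix y assume y: "y \<in> carrier H" "\<chi> y \<noteq> \<one>\<^bsub>integer_mod_group p\<^esub>"
    have "y [^]\<^bsub>H\<^esub> (p ^ Suc (\<alpha> 1)) = \<one>\<^bsub>H\<^esub>"
      using cyclic_p_sum_pow_eq_one[OF p, of y r \<beta>] y(1) \<beta>_le by (simp add: H_def del: power_Suc)
    then have "H.ord y dvd p ^ Suc (\<alpha> 1)" using H.pow_eq_id[OF y(1)] by simp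
    then obtain k where k: "k \<le> Suc (\<alpha> 1)" "H.ord y = p ^ k"
      using divides_primepow_nat[OF assms(1)] by blast
    \<comment> \<open>a smaller order would make \<open>p\<close> divide the first coordinate of \<open>y\<close>\<close>
    have "k = Suc (\<alpha> 1)"
    proof (rule ccontr)
      assume "k \<noteq> Suc (\<alpha> 1)"
      then have "H.ord y dvd p ^ \<alpha> 1" using k by (simp add: le_imp_power_dvd)
      then have "y [^]\<^bsub>H\<^esub> (p ^ \<alpha> 1) = \<one>\<^bsub>H\<^esub>" using H.pow_eq_id[OF y(1)] by simp
      then have "(\<lambda>i\<in>{1..r}. int (p ^ \<alpha> 1) * y i mod int (p ^ \<beta> i)) 1 = (\<lambda>i\<in>{1..r}. 0) 1"
        using cyclic_p_sum_pow[OF p, of y r \<beta> "p ^ \<alpha> 1"] y(1) H_simps(2) by (simp add: H_def)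
      then have "int (p ^ \<alpha> 1) * int p dvd int (p ^ \<alpha> 1) * y 1"
        using r1 by (auto simp: \<beta>_def mult.commute mod_eq_0_iff_dvd)
      then have "int p dvd y 1" using p by simp
      then show False using y(2) by (simp add: \<chi>_def)
    qed
    then show "H.ord y = p * p ^ \<alpha> 1" using k by simp
  qed
  show ?thesis using K1_eq by (simp add: G_def H_def \<beta>_def)
qed

end
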